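(* Let $r,t\in\mathbb{N}\cup\{0\}$ with $2r+t>2$. For $x>0$ define $$\mathscr{F}(x):=(-1)^r\sum_{j=0}^{t-2}\binom{j+r-1}{j}\frac{(-1)^{t-j}}{(t-j-1)!}\frac{1}{x^{j+r}}\sum_{m=1}^{\infty}\frac{\psi^{(t-j-1)}(mx+1)}{m^{2r+j}}$$ $$\qquad+\sum_{i=0}^{r-2}\frac{(-1)^i}{x^{t+i}}\binom{i+t-1}{i}\zeta(r+t+i)\zeta(r-i)-\frac{(-1)^r}{x^{r+t-1}}\binom{r+t-2}{t-1}\sum_{m=1}^{\infty}\frac{\gamma+\psi(mx+1)}{m^{2r+t-1}}.$$ Then, for all $x>0$, $$\mathscr{F}(x)=x^{-t}\,\mathscr{F}\left(\frac1x\right).$$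
   Context: $\mathbb{N}=\{1,2,3,\dots\}$. $\zeta$ is the Riemann zeta function, $\gamma$ is Euler's constant, $\psi=\Gamma'/\Gamma$ is the digamma function and $\psi^{(k)}$ its $k$-th derivative. Empty sums are $0$. Binomial convention: $\binom{-1}{0}=1$, $\binom{c}{-1}=0$ for any $c\in\mathbb{Z}\setminus\{-1\}$, $\binom{-1}{-1}=1$, and $\binom{a}{b}=0$ for integers $0\le a<b$. *)

theory Defs
  imports "HOL-Analysis.Analysis"
begin

(* The Riemann zeta function on its half-line of convergence s > 1; it is used only at
   integer arguments >= 2, so no analytic continuation is involved. *)
definition zeta :: "real \<Rightarrow> real" where
  "zeta s = (\<Sum>n. 1 / real (Suc n) powr s)"

(* Binomial coefficients with the conventions (-1 over 0) = (-1 over -1) = 1,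
   (c over -1) = 0 for c \<noteq> -1, and (a over b) = 0 for 0 \<le> a < b.
   Integer arguments are needed because j + r - 1, i + t - 1 and t - 1 can be -1.
   The remaining arguments with a < 0 or b < -1 get the dummy value 0. *)
definition binom :: "int \<Rightarrow> int \<Rightarrow> nat" where
  "binom a b =
     (if a = -1 \<and> (b = 0 \<or> b = -1) then 1
      else if 0 \<le> a \<and> 0 \<le> b then nat a choose nat b
      else 0)"

(* The k-th derivative of the digamma function, as an iterated derivative of the library's
   Digamma; on x > 0 the latter satisfies Gamma' = Gamma * Digamma
   (has_field_derivative_Gamma). *)
definition psi_deriv :: "nat \<Rightarrow> real \<Rightarrow> real" where
  "psi_deriv k = (deriv ^^ k) Digamma"

(* Sums over m >= 1 are suminf over m with Suc m in place of m.  The ranges j < t - 1 and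
   i < r - 1 stand for j = 0..t-2 and i = 0..r-2: truncated subtraction makes them empty
   for t \<le> 1 and r \<le> 1.  No other natural-number subtraction truncates when 2r + t > 2. *)
definition scrF :: "nat \<Rightarrow> nat \<Rightarrow> real \<Rightarrow> real" where
  "scrF r t x =
     (-1) ^ r * (\<Sum>j<t - 1.
        real (binom (int j + int r - 1) (int j))
        * ((-1) ^ (t - j) / fact (t - j - 1))
        * (1 / x ^ (j + r))
        * (\<Sum>m. psi_deriv (t - j - 1) (real (Suc m) * x + 1) / real (Suc m) ^ (2 * r + j)))
   + (\<Sum>i<r - 1.
        (-1) ^ i / x ^ (t + i)
        * real (binom (int i + int t - 1) (int i))
        * zeta (real (r + t + i)) * zeta (real (r - i)))
   - (-1) ^ r / x ^ (r + t - 1)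
     * real (binom (int r + int t - 2) (int t - 1))
     * (\<Sum>m. (euler_mascheroni + Digamma (real (Suc m) * x + 1))
             / real (Suc m) ^ (2 * r + t - 1))"

end

theory Submission
  imports Defs
begin

text \<open>
  \<open>\<F>(x)\<close> is an evaluation of the double series
  \<open>\<Sum>m,n\<ge>1. 1 / (m\<^sup>r n\<^sup>r (n + m x)\<^sup>t)\<close>, in which exchanging \<open>m\<close> and \<open>n\<close> replaces \<open>x\<close> by
  \<open>1/x\<close> at the cost of a factor \<open>x\<^sup>t\<close>. For fixed \<open>m\<close>, expanding the summand into partial
  fractions in \<open>n\<close> and summing over \<open>n\<close> yields zeta values from the powers of \<open>1/n\<close>,
  polygamma values from the powers of \<open>1/(n + m x)\<close>, and \<open>\<gamma> + \<psi>(m x + 1)\<close> from the two simple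
  poles, whose residues cancel.
\<close>

section \<open>Partial fraction expansion of a product of powers\<close>

text \<open>Half of the expansion of \<open>w ^ Suc p * z ^ Suc q\<close>: its powers of
  \<open>z\<close>. In the model case \<open>w = 1/a\<close>, \<open>z = 1/b\<close> the parameter
  \<open>c\<close> is \<open>1/(a + b)\<close>; treating it as a free ring element avoids
  division.\<close>

definition pf_sum :: "'a::comm_ring_1 \<Rightarrow> nat \<Rightarrow> nat \<Rightarrow> 'a \<Rightarrow> 'a" where
  "pf_sum c p q z = (\<Sum>j\<le>q. of_nat ((p + j) choose j) * c ^ (Suc p + j) * z ^ (Suc q - j))"

lemma pf_sum_0_0: "pf_sum c 0 0 z = c * z"
  by (simp add: pf_sum_def)

lemma pf_sum_Suc_0: "pf_sum c (Suc p) 0 z = c * pf_sum c p 0 z"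
  by (simp add: pf_sum_def algebra_simps)

lemma pf_sum_0_Suc: "pf_sum c 0 (Suc q) z = c * (pf_sum c 0 q z + z ^ Suc (Suc q))"
  unfolding pf_sum_def by (subst sum.atMost_Suc_shift) (simp add: algebra_simps sum_distrib_left)

text \<open>Pascal's rule for the coefficients. The term \<open>j = 0\<close> is split off because
  only \<open>pf_sum c p (Suc q) z\<close> contributes to the top power of \<open>z\<close>.\<close>

lemma pf_sum_Suc_Suc:
  "pf_sum c (Suc p) (Suc q) z = c * (pf_sum c (Suc p) q z + pf_sum c p (Suc q) z)"
proof -
  have "pf_sum c (Suc p) (Suc q) z = c ^ Suc (Suc p) * z ^ Suc (Suc q)
      + (\<Sum>j\<le>q. of_nat ((Suc p + Suc j) choose Suc j) * c ^ (Suc (Suc p) + Suc j) * z ^ (Suc q - j))"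
    unfolding pf_sum_def by (subst sum.atMost_Suc_shift) simp
  also have "(\<Sum>j\<le>q. of_nat ((Suc p + Suc j) choose Suc j) * c ^ (Suc (Suc p) + Suc j) * z ^ (Suc q - j))
      = c * (\<Sum>j\<le>q. of_nat ((Suc p + j) choose j) * c ^ (Suc (Suc p) + j) * z ^ (Suc q - j))
      + c * (\<Sum>j\<le>q. of_nat ((p + Suc j) choose Suc j) * c ^ (Suc p + Suc j) * z ^ (Suc q - j))"
    unfolding sum_distrib_left sum.distrib[symmetric]
    by (rule sum.cong) (simp_all add: algebra_simps)
  also have "(\<Sum>j\<le>q. of_nat ((Suc p + j) choose j) * c ^ (Suc (Suc p) + j) * z ^ (Suc q - j))
      = pf_sum c (Suc p) q z"
    by (simp add: pf_sum_def)
  also have "(\<Sum>j\<le>q. of_nat ((p + Suc j) choose Suc j) * c ^ (Suc p + Suc j) * z ^ (Suc q - j))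
      = pf_sum c p (Suc q) z - c ^ Suc p * z ^ Suc (Suc q)"
    unfolding pf_sum_def by (subst sum.atMost_Suc_shift) simp
  finally show ?thesis
    by (simp add: algebra_simps)
qed

text \<open>Replacing one factor \<open>w * z\<close> by \<open>c * (w + z)\<close> lowers one
  exponent in each summand, and \<open>pf_sum\<close> obeys the same recurrence.\<close>

lemma power_mult_power_eq_pf_sum:
  fixes w z c :: "'a::comm_ring_1"
  assumes "w * z = c * (w + z)"
  shows "w ^ Suc p * z ^ Suc q = pf_sum c q p w + pf_sum c p q z"
proof (induction "p + q" arbitrary: p q)
  case 0
  then show ?case
    using assms by (simp add: pf_sum_0_0 algebra_simps)
next
  case (Suc k)
  have step: "w ^ Suc p * z ^ Suc q = c * (w ^ Suc p * z ^ q + w ^ p * z ^ Suc q)"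
  proof -
    have "w ^ Suc p * z ^ Suc q = w ^ p * z ^ q * (w * z)"
      by (simp add: algebra_simps)
    then show ?thesis
      unfolding assms by (simp add: algebra_simps)
  qed
  \<comment> \<open>If \<open>p = 0\<close>, the summand \<open>w ^ p * z ^ Suc q\<close> is a pure
    power of \<open>z\<close>, which is the extra term in \<open>pf_sum_0_Suc\<close>; the case
    \<open>q = 0\<close> is symmetric.\<close>
  show ?case
  proof (cases p)
    case 0
    then obtain q' where q: "q = Suc q'"
      using Suc by (cases q) auto
    have "w ^ Suc 0 * z ^ Suc q' = pf_sum c q' 0 w + pf_sum c 0 q' z"
      using Suc(1)[of 0 q'] Suc(2) 0 q by simp
    then show ?thesis
      unfolding step unfolding 0 q pf_sum_Suc_0 pf_sum_0_Suc
      by (simp add: algebra_simps)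
  next
    case p: (Suc p')
    show ?thesis
    proof (cases q)
      case 0
      have "w ^ Suc p' * z ^ Suc 0 = pf_sum c 0 p' w + pf_sum c p' 0 z"
        using Suc(1)[of p' 0] Suc(2) 0 p by simp
      then show ?thesis
        unfolding step unfolding 0 p pf_sum_Suc_0 pf_sum_0_Suc
        by (simp add: algebra_simps)
    next
      case q: (Suc q')
      have "w ^ Suc p * z ^ Suc q' = pf_sum c q' p w + pf_sum c p q' z"
        "w ^ Suc p' * z ^ Suc q = pf_sum c q p' w + pf_sum c p' q z"
        using Suc(1)[of p q'] Suc(1)[of p' q] Suc(2) p q by auto
      then show ?thesis
        unfolding step unfolding p q pf_sum_Suc_Suc
        by (simp add: algebra_simps)
    qed
  qed
qed

text \<open>
  The hypothesis holds for \<open>y = 1/n\<close>, \<open>z = 1/(n + a)\<close>, \<open>c = 1/a\<close>. The simple-pole terms are split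
  off because only their difference is summable over \<open>n\<close>.
\<close>

lemma partial_fraction_power:
  fixes y z c :: real
  assumes "y * z = c * (y - z)"
  shows "y ^ Suc p * z ^ Suc q =
      (\<Sum>i<p. (-1) ^ i * real ((q + i) choose i) * c ^ (Suc q + i) * y ^ (Suc p - i))
    - (-1) ^ p * (\<Sum>j<q. real ((p + j) choose j) * c ^ (Suc p + j) * z ^ (Suc q - j))
    + (-1) ^ p * real ((p + q) choose q) * c ^ (Suc p + q) * (y - z)"
proof -
  \<comment> \<open>The previous expansion is applied to \<open>w = -y\<close>; the signs combine to
    \<open>(-1) ^ i\<close> since \<open>Suc p + (Suc p - i)\<close> has the parity of
    \<open>i\<close>.\<close>
  have neg: "(-1) ^ Suc p * pf_sum c q p (-y) =
      (\<Sum>i\<le>p. (-1) ^ i * real ((q + i) choose i) * c ^ (Suc q + i) * y ^ (Suc p - i))"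
    unfolding pf_sum_def sum_distrib_left
  proof (rule sum.cong)
    fix i assume "i \<in> {..p}"
    then obtain d where d: "p = i + d"
      using le_Suc_ex by auto
    have eq: "Suc p - i = Suc d"
      using d by simp
    have pm: "(-1 :: real) ^ i * ((-1) ^ d * ((-1) ^ d * u)) = (-1) ^ i * u" for u
      by (simp add: power_mult_distrib[symmetric] mult.assoc[symmetric])
    show "(-1) ^ Suc p * (real ((q + i) choose i) * c ^ (Suc q + i) * (- y) ^ (Suc p - i))
      = (-1) ^ i * real ((q + i) choose i) * c ^ (Suc q + i) * y ^ (Suc p - i)"
      unfolding eq power_minus[of y] unfolding d power_Suc power_add
      using pm[of "real ((q + i) choose i) * (c * c ^ q * c ^ i) * (y * y ^ d)"]
      by (simp add: algebra_simps)
  qed simp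
  have "(-y) ^ Suc p * z ^ Suc q = pf_sum c q p (-y) + pf_sum c p q z"
    using assms by (intro power_mult_power_eq_pf_sum) (simp add: algebra_simps)
  then have "(-1) ^ Suc p * ((-y) ^ Suc p * z ^ Suc q)
      = (-1) ^ Suc p * pf_sum c q p (-y) + (-1) ^ Suc p * pf_sum c p q z"
    by (simp only: distrib_left)
  also have "(-1) ^ Suc p * ((-y) ^ Suc p * z ^ Suc q) = y ^ Suc p * z ^ Suc q"
    unfolding mult.assoc[symmetric] power_mult_distrib[symmetric] by simp
  finally have "y ^ Suc p * z ^ Suc q =
      (-1) ^ Suc p * pf_sum c q p (-y) + (-1) ^ Suc p * pf_sum c p q z" .
  \<comment> \<open>The terms \<open>i = p\<close> and \<open>j = q\<close> are the simple poles; by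
    symmetry of the binomial coefficient they merge into a multiple of \<open>y - z\<close>.\<close>
  then show ?thesis
    unfolding neg unfolding pf_sum_def lessThan_Suc_atMost[symmetric] sum.lessThan_Suc
    using binomial_symmetric[of q "p + q"]
    by (simp add: algebra_simps)
qed

section \<open>Summing the individual partial fractions\<close>

lemma zeta_sums:
  assumes "k \<ge> 2"
  shows "(\<lambda>n. (1 / real (Suc n)) ^ k) sums zeta (real k)"
proof -
  have "summable (\<lambda>n. inverse (real n ^ k))"
    using inverse_power_summable[OF assms, where 'a = real] by simp
  then have "summable (\<lambda>n. inverse (real (Suc n) ^ k))"
    by (subst summable_Suc_iff)
  moreover have "inverse (real (Suc n) ^ k) = (1 / real (Suc n)) ^ k" for n
    by (simp add: field_simps)
  moreover have "zeta (real k) = (\<Sum>n. (1 / real (Suc n)) ^ k)"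
    unfolding zeta_def by (simp add: powr_realpow power_one_over del: of_nat_Suc)
  ultimately show ?thesis
    by (simp add: summable_sums)
qed

text \<open>The polygamma series at \<open>a + 1\<close>, where the shift makes the first term
  \<open>1/(1 + a)\<close>. It diverges for \<open>k = 0\<close>; simple poles are left to
  \<open>Digamma_sums\<close>.\<close>

lemma psi_deriv_sums:
  assumes "k > 0" "a > 0"
  shows "(\<lambda>n. (1 / (real (Suc n) + a)) ^ Suc k) sums
           ((-1) ^ Suc k / fact k * psi_deriv k (a + 1))"
proof -
  have "a + 1 \<notin> \<int>\<^sub>\<le>\<^sub>0"
    using assms by (auto elim!: nonpos_Ints_cases)
  then have "psi_deriv k (a + 1) = Polygamma k (a + 1)"
    unfolding psi_deriv_def using higher_deriv_Polygamma[of "a + 1" k 0] by simp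
  moreover have "inverse ((a + 1 + real n) ^ Suc k) = (1 / (real (Suc n) + a)) ^ Suc k" for n
    by (simp add: divide_simps add_ac)
  ultimately show ?thesis
    using Polygamma_LIMSEQ[of "a + 1" k] assms by simp
qed

lemma Digamma_sums:
  fixes a :: real
  assumes "a > 0"
  shows "(\<lambda>n. 1 / real (Suc n) - 1 / (real (Suc n) + a)) sums
           (euler_mascheroni + Digamma (a + 1))"
proof -
  have "inverse (real (Suc n)) - inverse (a + 1 + real n)
      = 1 / real (Suc n) - 1 / (real (Suc n) + a)" for n
    by (simp add: inverse_eq_divide add_ac)
  then show ?thesis
    using summable_sums[OF summable_Digamma[of "a + 1"]] assms by (simp add: Digamma_def)
qed

section \<open>The double series: symmetry and convergence\<close>

definition tornheim_term :: "nat \<Rightarrow> nat \<Rightarrow> real \<Rightarrow> nat \<Rightarrow> nat \<Rightarrow> real" where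
  "tornheim_term r t x m n =
     (1 / real (Suc m)) ^ r * ((1 / real (Suc n)) ^ r * (1 / (real (Suc n) + real (Suc m) * x)) ^ t)"

lemma tornheim_term_nonneg: "x > 0 \<Longrightarrow> tornheim_term r t x m n \<ge> 0"
  by (simp add: tornheim_term_def)

text \<open>Factor \<open>x\<close> out of the linear form:
  \<open>n + m x = x (m + n/x)\<close>.\<close>

lemma tornheim_term_inverse:
  assumes "x > 0"
  shows "tornheim_term r t x m n = x powi (- int t) * tornheim_term r t (1 / x) n m"
proof -
  have "1 / (real (Suc n) + real (Suc m) * x) = 1 / x * (1 / (real (Suc m) + real (Suc n) * (1 / x)))"
    using assms by (simp add: divide_simps)
  moreover have "x powi (- int t) = (1 / x) ^ t"
    by (simp add: power_int_minus field_simps)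
  ultimately show ?thesis
    unfolding tornheim_term_def by (simp only: power_mult_distrib mult_ac)
qed

text \<open>Comparison with the product of two convergent series of exponent 3/2.\<close>

lemma tornheim_term_summable:
  assumes "2 * r + t > 2" "x > 0"
  shows "(\<lambda>(m, n). tornheim_term r t x m n) summable_on UNIV \<times> UNIV"
proof -
  \<comment> \<open>This is \<open>Suc n\<close> to the power -3/2, written as a cube so that the
    comparison needs only natural exponents.\<close>
  define b where "b n = (1 / sqrt (real (Suc n))) ^ 3" for n
  have b_nonneg: "b n \<ge> 0" for n
    by (simp add: b_def)
  have "summable (\<lambda>n. real n powr (-(3/2)))"
    by (simp add: summable_real_powr_iff)
  then have "summable (\<lambda>n. real (Suc n) powr (-(3/2)))"
    by (subst summable_Suc_iff)
  moreover have "real (Suc n) powr (-(3/2)) = b n" for n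
  proof -
    have "real (Suc n) powr (-(3/2)) = (real (Suc n) powr (-(1/2))) powr (real 3)"
      by (simp add: powr_powr)
    also have "\<dots> = b n"
      unfolding b_def by (subst powr_realpow) (auto simp: powr_minus powr_half_sqrt field_simps)
    finally show ?thesis .
  qed
  ultimately have "summable b"
    by simp
  then have b: "b summable_on UNIV"
    using b_nonneg by (simp add: summable_on_UNIV_nonneg_real_iff)
  have "((\<lambda>n. b m * b n) has_sum (b m * infsum b UNIV)) UNIV" for m
    by (intro has_sum_cmult_right has_sum_infsum b)
  moreover have "(\<lambda>m. b m * infsum b UNIV) summable_on UNIV"
    by (intro summable_on_cmult_left b)
  ultimately have "(\<lambda>(m, n). b m * b n) summable_on UNIV \<times> UNIV"
    by (intro summable_on_SigmaI[where g = "\<lambda>m. b m * infsum b UNIV"]) (auto simp: b_nonneg)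
  then have "(\<lambda>z. (1 / (2 * sqrt x)) ^ t * (case z of (m, n) \<Rightarrow> b m * b n)) summable_on UNIV \<times> UNIV"
    by (rule summable_on_cmult_right)
  then show ?thesis
  proof (rule summable_on_comparison_test)
    fix z :: "nat \<times> nat"
    obtain m n where z: "z = (m, n)"
      by (cases z)
    define M N u where "M = real (Suc m)" and "N = real (Suc n)" and "u = 1 / sqrt M * (1 / sqrt N)"
    have MN: "M \<ge> 1" "N \<ge> 1"
      by (simp_all add: M_def N_def)
    have u: "0 \<le> u" "u \<le> 1"
      unfolding u_def using MN
      by (auto intro!: mult_le_one simp: divide_le_eq
          simp del: times_divide_eq_right times_divide_eq_left)
    \<comment> \<open>AM-GM bounds the term by a constant multiple of \<open>(m n) powr -(r + t/2)\<close>.\<close>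
    have "2 * (sqrt x * sqrt M * sqrt N) \<le> N + M * x"
    proof -
      have "0 \<le> (sqrt N - sqrt M * sqrt x)\<^sup>2"
        by simp
      also have "\<dots> = N + M * x - 2 * (sqrt x * sqrt M * sqrt N)"
        using MN assms by (simp add: power2_diff power_mult_distrib)
      finally show ?thesis
        by simp
    qed
    then have "1 / (N + M * x) \<le> 1 / (2 * (sqrt x * sqrt M * sqrt N))"
      using MN assms by (intro divide_left_mono) (auto intro!: mult_pos_pos add_pos_pos)
    also have "\<dots> = 1 / (2 * sqrt x) * u"
      by (simp add: u_def)
    finally have le: "1 / (N + M * x) \<le> 1 / (2 * sqrt x) * u" .
    have "1 / M * (1 / N) = u\<^sup>2"
      using MN by (simp add: u_def power_divide power_mult_distrib)
    then have "tornheim_term r t x m n = (u\<^sup>2) ^ r * (1 / (N + M * x)) ^ t"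
      unfolding tornheim_term_def M_def[symmetric] N_def[symmetric]
      by (simp only: mult.assoc[symmetric] power_mult_distrib[symmetric])
    also have "\<dots> \<le> (u\<^sup>2) ^ r * (1 / (2 * sqrt x) * u) ^ t"
      using MN assms le by (intro mult_left_mono power_mono) auto
    also have "\<dots> = (1 / (2 * sqrt x)) ^ t * u ^ (2 * r + t)"
      by (simp add: power_mult_distrib power_add power_mult power_divide)
    \<comment> \<open>Here \<open>2 * r + t > 2\<close> enters: the exponent is at least 3 and
      \<open>u \<le> 1\<close>.\<close>
    also have "\<dots> \<le> (1 / (2 * sqrt x)) ^ t * u ^ 3"
      using u assms by (intro mult_left_mono power_decreasing) auto
    also have "u ^ 3 = b m * b n"
      unfolding u_def b_def M_def N_def by (simp only: power_mult_distrib)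
    finally show "(case z of (m, n) \<Rightarrow> tornheim_term r t x m n)
        \<le> (1 / (2 * sqrt x)) ^ t * (case z of (m, n) \<Rightarrow> b m * b n)"
      by (simp add: z)
    show "0 \<le> (case z of (m, n) \<Rightarrow> tornheim_term r t x m n)"
      using assms by (simp add: z tornheim_term_nonneg)
  qed
qed

section \<open>From row sums to the double sum\<close>

text \<open>Fubini. The summability of the row sums is a conclusion, from which convergence of the
  series inside \<open>scrF\<close> is later deduced.\<close>

lemma has_sum_suminf_rows:
  fixes f :: "nat \<Rightarrow> nat \<Rightarrow> real"
  assumes "(\<lambda>(m, n). f m n) summable_on UNIV \<times> UNIV"
    and "\<And>m n. f m n \<ge> 0"
    and "\<And>m. f m sums S m"
  shows "((\<lambda>(m, n). f m n) has_sum suminf S) (UNIV \<times> UNIV)" "summable S"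
proof -
  obtain s where s: "((\<lambda>(m, n). f m n) has_sum s) (UNIV \<times> UNIV)"
    using assms(1) by (auto simp: summable_on_def)
  have "(S has_sum s) UNIV"
    by (rule has_sum_SigmaD[OF s]) (auto intro: sums_nonneg_imp_has_sum assms)
  then have "S sums s"
    by (rule has_sum_imp_sums)
  then show "((\<lambda>(m, n). f m n) has_sum suminf S) (UNIV \<times> UNIV)" "summable S"
    using s by (auto simp: sums_iff)
qed

text \<open>Moves constants out of \<open>suminf\<close> when only the scaled series is known to
  converge; \<open>c \<noteq> 0\<close> transfers convergence to \<open>f\<close>.\<close>

lemma sums_cmult_summable:
  fixes f :: "nat \<Rightarrow> 'a::real_normed_field"
  assumes "c \<noteq> 0" "summable (\<lambda>n. c * f n)"
  shows "(\<lambda>n. c * f n) sums (c * suminf f)"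
  using assms by (intro sums_mult summable_sums) (simp add: summable_cmult_iff)

section \<open>Identifying \<open>scrF\<close> with the double sum\<close>

text \<open>By the binomial convention the coefficient with top \<open>j - 1\<close> is 1 at
  \<open>j = 0\<close> and 0 afterwards; the digamma coefficient has lower index above the upper one
  and vanishes.\<close>

lemma scrF_0_Suc:
  assumes "q \<ge> 2"
  shows "scrF 0 (Suc q) x =
    (-1) ^ Suc q / fact q * (\<Sum>m. psi_deriv q (real (Suc m) * x + 1))"
proof -
  let ?s = "\<lambda>j. \<Sum>m. psi_deriv (Suc q - j - 1) (real (Suc m) * x + 1) / real (Suc m) ^ (2 * 0 + j)"
  have "(\<Sum>j<q. real (binom (int j + int 0 - 1) (int j))
        * ((-1) ^ (Suc q - j) / fact (Suc q - j - 1)) * (1 / x ^ (j + 0)) * ?s j)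
      = (\<Sum>j<q. if j = 0 then (-1) ^ Suc q / fact q * ?s 0 else 0)"
    by (rule sum.cong) (auto simp: binom_def)
  also have "\<dots> = (-1) ^ Suc q / fact q * ?s 0"
    using assms by simp
  finally have first: "(\<Sum>j<q. real (binom (int j + int 0 - 1) (int j))
        * ((-1) ^ (Suc q - j) / fact (Suc q - j - 1)) * (1 / x ^ (j + 0)) * ?s j)
      = (-1) ^ Suc q / fact q * ?s 0" .
  have last: "binom (int 0 + int (Suc q) - 2) (int (Suc q) - 1) = 0"
    using assms by (auto simp: binom_def)
  show ?thesis
    unfolding scrF_def last diff_Suc_1 using first by simp
qed

text \<open>Again only \<open>i = 0\<close> survives in the zeta sum. The digamma coefficient has
  lower index -1 and upper index \<open>r - 2 \<ge> 0\<close>, hence is 0.\<close>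

lemma scrF_0_right:
  assumes "r \<ge> 2"
  shows "scrF r 0 x = zeta (real r) * zeta (real r)"
proof -
  have "(\<Sum>i<r - 1. (-1) ^ i / x ^ (0 + i) * real (binom (int i + int 0 - 1) (int i))
        * zeta (real (r + 0 + i)) * zeta (real (r - i)))
      = (\<Sum>i<r - 1. if i = 0 then zeta (real r) * zeta (real r) else 0)"
    by (rule sum.cong) (auto simp: binom_def)
  then show ?thesis
    using assms by (simp add: scrF_def binom_def)
qed

text \<open>For positive \<open>r\<close> and \<open>t\<close> all binomials are ordinary ones; the
  form is chosen to match \<open>partial_fraction_power\<close> term by term.\<close>

lemma scrF_Suc_Suc:
  "scrF (Suc p) (Suc q) x =
    (\<Sum>i<p. (-1) ^ i * real ((q + i) choose i) * (1 / x) ^ (Suc q + i) * zeta (real (Suc p - i))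
        * zeta (real (Suc p + Suc q + i)))
    - (-1) ^ p * (\<Sum>j<q. real ((p + j) choose j) * (1 / x) ^ (Suc p + j)
        * ((-1) ^ Suc (q - j) / fact (q - j)
        * (\<Sum>m. psi_deriv (q - j) (real (Suc m) * x + 1) / real (Suc m) ^ (2 * Suc p + j))))
    + (-1) ^ p * real ((p + q) choose q) * (1 / x) ^ (Suc p + q)
       * (\<Sum>m. (euler_mascheroni + Digamma (real (Suc m) * x + 1)) / real (Suc m) ^ (2 * Suc p + q))"
proof -
  have b1: "binom (int j + int (Suc p) - 1) (int j) = (p + j) choose j" for j
    by (simp add: binom_def nat_add_distrib add_ac)
  have b2: "binom (int i + int (Suc q) - 1) (int i) = (q + i) choose i" for i
    by (simp add: binom_def nat_add_distrib add_ac)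
  have b3: "binom (int (Suc p) + int (Suc q) - 2) (int (Suc q) - 1) = (p + q) choose q"
    by (simp add: binom_def nat_add_distrib)
  have e: "2 * Suc p + Suc q - 1 = 2 * Suc p + q" "Suc p + Suc q - 1 = Suc p + q"
     "Suc q - 1 = q" "Suc p - 1 = p"
    by simp_all
  have s1: "(\<Sum>j<q. real ((p + j) choose j) * ((-1) ^ (Suc q - j) / fact (Suc q - j - 1)) * (1 / x ^ (j + Suc p)) * s j)
    = (\<Sum>j<q. real ((p + j) choose j) * (1 / x) ^ (Suc p + j) * ((-1) ^ Suc (q - j) / fact (q - j) * s j))" for s
    by (rule sum.cong) (auto simp: power_one_over Suc_diff_le add_ac mult_ac)
  show ?thesis
    unfolding scrF_def b1 b2 b3 e s1
    by (simp add: power_one_over mult_ac add_ac)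
qed

text \<open>If \<open>r = 0\<close> or \<open>t = 0\<close>, each row is already a polygamma or zeta
  series; otherwise it is expanded into partial fractions.\<close>

lemma scrF_has_sum:
  assumes "2 * r + t > 2" "x > 0"
  shows "((\<lambda>(m, n). tornheim_term r t x m n) has_sum scrF r t x) (UNIV \<times> UNIV)"
proof -
  note rows = has_sum_suminf_rows[OF tornheim_term_summable[OF assms] tornheim_term_nonneg[OF assms(2)]]
  define P where "P k m = (-1) ^ Suc k / fact k * psi_deriv k (real (Suc m) * x + 1)" for k m
  have P: "(\<lambda>n. (1 / (real (Suc n) + real (Suc m) * x)) ^ Suc k) sums P k m" if "k > 0" for k m
    unfolding P_def using that assms by (intro psi_deriv_sums) (simp_all add: add_pos_nonneg)
  consider "r = 0" | "t = 0" | "r > 0" "t > 0"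
    by blast
  then show ?thesis
  proof cases
    assume r: "r = 0"
    then obtain q where t: "t = Suc q" and q: "q \<ge> 2"
      using assms by (cases t) auto
    have "tornheim_term r t x m sums P q m" for m
      using P[of q m] q unfolding tornheim_term_def r t by simp
    note PQ = rows[OF this]
    have "P q sums scrF r t x"
      using PQ(2) unfolding r t scrF_0_Suc[OF q] P_def by (intro sums_cmult_summable) auto
    with PQ(1) show ?thesis
      by (simp add: sums_iff)
  next
    assume t: "t = 0"
    then have r: "r \<ge> 2"
      using assms by simp
    have "tornheim_term r t x m sums ((1 / real (Suc m)) ^ r * zeta (real r))" for m
      unfolding tornheim_term_def t using sums_mult[OF zeta_sums[OF r]] by simp
    from rows(1)[OF this]
    have "((\<lambda>(m, n). tornheim_term r t x m n) has_sum (\<Sum>m. (1 / real (Suc m)) ^ r * zeta (real r))) (UNIV \<times> UNIV)" .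
    also have "(\<Sum>m. (1 / real (Suc m)) ^ r * zeta (real r)) = scrF r t x"
      using sums_unique[OF sums_mult2[OF zeta_sums[OF r]]] r t by (simp add: scrF_0_right)
    finally show ?thesis .
  next
    assume "r > 0" "t > 0"
    then obtain p q where r: "r = Suc p" and t: "t = Suc q"
      by (metis gr0_implies_Suc)
    \<comment> \<open>\<open>A\<close>, \<open>B\<close> and \<open>E\<close> carry the zeta,
      polygamma and digamma parts of row \<open>m\<close>; the factors \<alpha>, \<beta> and
      \<kappa> do not depend on \<open>m\<close>.\<close>
    define D where "D m = euler_mascheroni + Digamma (real (Suc m) * x + 1)" for m
    define \<alpha> where "\<alpha> i = (-1) ^ i * real ((q + i) choose i) * (1 / x) ^ (Suc q + i) * zeta (real (Suc p - i))" for i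
    define \<beta> where "\<beta> j = real ((p + j) choose j) * (1 / x) ^ (Suc p + j)" for j
    define \<kappa> where "\<kappa> = (-1) ^ p * real ((p + q) choose q) * (1 / x) ^ (Suc p + q)"
    define A where "A m = (\<Sum>i<p. \<alpha> i * (1 / real (Suc m)) ^ (Suc p + Suc q + i))" for m
    define B where "B m = (\<Sum>j<q. \<beta> j * (P (q - j) m / real (Suc m) ^ (2 * Suc p + j)))" for m
    define E where "E m = D m / real (Suc m) ^ (2 * Suc p + q)" for m
    have \<kappa>: "\<kappa> \<noteq> 0"
      using assms by (simp add: \<kappa>_def)
    have row: "tornheim_term r t x m sums (A m - (-1) ^ p * B m + \<kappa> * E m)" for m
    proof -
      define M where "M = real (Suc m)"
      define c where "c = 1 / (M * x)"
      define y where "y n = 1 / real (Suc n)" for n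
      define z where "z n = 1 / (real (Suc n) + M * x)" for n
      have M: "M > 0"
        by (simp add: M_def)
      have "y n * z n = c * (y n - z n)" for n
      proof -
        have "real (Suc n) + M * x > 0"
          using M assms by (intro add_pos_pos) auto
        then show ?thesis
          using M assms by (simp add: y_def z_def c_def field_simps)
      qed
      note pf = partial_fraction_power[OF this]
      have "(\<lambda>n. y n ^ Suc p * z n ^ Suc q) sums
        ((\<Sum>i<p. (-1) ^ i * real ((q + i) choose i) * c ^ (Suc q + i) * zeta (real (Suc p - i)))
        - (-1) ^ p * (\<Sum>j<q. real ((p + j) choose j) * c ^ (Suc p + j) * P (q - j) m)
        + (-1) ^ p * real ((p + q) choose q) * c ^ (Suc p + q) * D m)" (is "_ sums ?S")
        unfolding pf
      proof (intro sums_add sums_diff sums_mult sums_sum)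
        fix i assume "i \<in> {..<p}"
        then show "(\<lambda>n. y n ^ (Suc p - i)) sums zeta (real (Suc p - i))"
          unfolding y_def by (intro zeta_sums) auto
      next
        fix j assume "j \<in> {..<q}"
        then show "(\<lambda>n. z n ^ (Suc q - j)) sums P (q - j) m"
          using P[of "q - j" m] by (simp add: z_def M_def Suc_diff_le)
      next
        show "(\<lambda>n. y n - z n) sums D m"
          unfolding y_def z_def D_def M_def using assms by (intro Digamma_sums) (simp add: add_pos_nonneg)
      qed
      then have "(\<lambda>n. (1 / M) ^ Suc p * (y n ^ Suc p * z n ^ Suc q)) sums ((1 / M) ^ Suc p * ?S)"
        by (rule sums_mult)
      \<comment> \<open>The powers of \<open>1/M\<close> inside \<open>c = 1/(M * x)\<close> join
        the prefactor, giving the exponents \<open>r + t + i\<close>, \<open>2r + j\<close> and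
        \<open>2r + t - 1\<close>.\<close>
      moreover have "(1 / M) ^ Suc p * ?S = A m - (-1) ^ p * B m + \<kappa> * E m"
        unfolding A_def B_def E_def \<alpha>_def \<beta>_def \<kappa>_def M_def[symmetric] c_def mult_2
        by (simp add: algebra_simps sum_distrib_left power_add power_divide power_mult_distrib)
      ultimately show ?thesis
        unfolding tornheim_term_def r t y_def z_def M_def by simp
    qed
    have A: "A sums (\<Sum>i<p. \<alpha> i * zeta (real (Suc p + Suc q + i)))"
      unfolding A_def by (intro sums_sum sums_mult zeta_sums) auto
    \<comment> \<open>Dropping \<open>m x\<close> from the denominators bounds \<open>P k m\<close>
      by \<open>zeta (Suc k)\<close> uniformly in \<open>m\<close>, and the remaining exponent of
      \<open>1/m\<close> is at least 2.\<close>
    have P_summable: "summable (\<lambda>m. P (q - j) m / real (Suc m) ^ (2 * Suc p + j))" if "j < q" for j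
    proof (rule summable_comparison_test')
      define k where "k = q - j"
      have k: "k > 0"
        using that by (simp add: k_def)
      show "summable (\<lambda>m. zeta (real (Suc k)) * (1 / real (Suc m)) ^ (2 * Suc p + j))"
        by (intro summable_mult sums_summable[OF zeta_sums]) auto
      fix m :: nat
      have le: "(1 / (real (Suc n) + real (Suc m) * x)) ^ Suc k \<le> (1 / real (Suc n)) ^ Suc k" for n
        using assms by (intro power_mono frac_le) auto
      have "P k m \<le> zeta (real (Suc k))"
        using k by (intro sums_le[OF le P zeta_sums]) auto
      moreover have "0 \<le> P k m"
        using k assms by (intro sums_le[OF _ sums_zero P]) auto
      ultimately show "norm (P (q - j) m / real (Suc m) ^ (2 * Suc p + j))
          \<le> zeta (real (Suc k)) * (1 / real (Suc m)) ^ (2 * Suc p + j)"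
        unfolding k_def[symmetric] by (simp add: power_one_over divide_right_mono del: of_nat_Suc)
    qed
    have P_sums: "(\<lambda>m. P (q - j) m / real (Suc m) ^ (2 * Suc p + j)) sums
        ((-1) ^ Suc (q - j) / fact (q - j)
          * (\<Sum>m. psi_deriv (q - j) (real (Suc m) * x + 1) / real (Suc m) ^ (2 * Suc p + j)))"
      if "j < q" for j
      using P_summable[OF that] unfolding P_def times_divide_eq_right[symmetric]
      by (intro sums_cmult_summable) auto
    have B: "B sums (\<Sum>j<q. \<beta> j * ((-1) ^ Suc (q - j) / fact (q - j)
          * (\<Sum>m. psi_deriv (q - j) (real (Suc m) * x + 1) / real (Suc m) ^ (2 * Suc p + j))))"
      unfolding B_def by (intro sums_sum sums_mult P_sums) auto
    \<comment> \<open>Convergence of the row sums yields that of the digamma series, with no growth estimate.\<close>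
    have "summable (\<lambda>m. (1 / \<kappa>) * ((A m - (-1) ^ p * B m + \<kappa> * E m) - A m + (-1) ^ p * B m))"
      by (intro summable_mult summable_add summable_diff rows(2)[OF row] sums_summable[OF A] sums_summable[OF B])
    then have "summable E"
      using \<kappa> by simp
    then have E: "E sums suminf E"
      by (rule summable_sums)
    have "(\<lambda>m. A m - (-1) ^ p * B m + \<kappa> * E m) sums scrF r t x"
      using sums_add[OF sums_diff[OF A sums_mult[OF B, of "(-1) ^ p"]] sums_mult[OF E, of \<kappa>]]
      unfolding r t scrF_Suc_Suc E_def D_def \<alpha>_def \<beta>_def \<kappa>_def by simp
    with rows(1)[OF row] show ?thesis
      by (simp add: sums_iff)
  qed
qed

section \<open>Exchanging the summation indices\<close>

theorem theorem3p3:
  fixes r t :: nat and x :: real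
  assumes "2 * r + t > 2" and "x > 0"
  shows "scrF r t x = x powi (- int t) * scrF r t (1 / x)"
proof -
  have "((\<lambda>(m, n). tornheim_term r t x m n) has_sum scrF r t x) (UNIV \<times> UNIV)"
    using assms by (rule scrF_has_sum)
  then have "((\<lambda>(n, m). tornheim_term r t x m n) has_sum scrF r t x) (UNIV \<times> UNIV)"
    by (subst (asm) has_sum_swap) (simp add: case_prod_unfold)
  moreover have "((\<lambda>z. x powi (- int t) * (case z of (n, m) \<Rightarrow> tornheim_term r t (1 / x) n m)) has_sum
      x powi (- int t) * scrF r t (1 / x)) (UNIV \<times> UNIV)"
    using assms by (intro has_sum_cmult_right scrF_has_sum) auto
  \<comment> \<open>With the indices swapped, both sums have the same summand, so uniqueness of the
    sum gives the identity.\<close>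
  moreover have "(\<lambda>(n, m). tornheim_term r t x m n)
      = (\<lambda>z. x powi (- int t) * (case z of (n, m) \<Rightarrow> tornheim_term r t (1 / x) n m))"
    using tornheim_term_inverse[OF assms(2)] by auto
  ultimately show ?thesis
    by (metis has_sum_unique)
qed

end
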